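(* Assume the following four conditions. (1) For all $\theta_1,\theta_2\in\Theta$, $f(\cdot,\theta_1)=f(\cdot,\theta_2)$ (a.s.) implies $\theta_1=\theta_2$. (2) For all $\theta_0\in\Theta$, $s(\cdot,\theta_0)$ is continuous on $\Theta$ and $\liminf_{x\to b}s(x,\theta_0)>s(\theta_0,\theta_0)$ for all $b\in\mathcal{C}^*(\Theta)\setminus\Theta$. (3) The family $\{f(\cdot,\theta)\}_{\theta\in\Theta}$ has a common support set $\mathcal{S}=\{x\in\mathbb{R}^p:0<f(x,\theta)<\infty\}$ (not depending on $\theta$), and for all $x\in\mathcal{S}$, $f(x,\cdot)$ is continuous on $\Theta$. (4) For any $\theta\in\Theta$ and any compact subset $K$ of $\Theta$, $\int\sup_{\phi\in K}|\log(f(x,\phi))|\,f(x,\theta)\,d\mu(x)<\infty$. Then for all $\epsilon>0$ and any compact subset $\mathfrak{B}_*^\epsilon$ of $\Theta\setminus B_s(\theta_0,\epsilon)$, $\{-\log(l_n)\}$ strongly separates $\mathfrak{A}^\epsilon$ from $\mathfrak{B}_*^\epsilon$; that is, as $n\to\infty$, $$P\left(\sup_{\theta\in\mathfrak{A}^\epsilon}\big[-\log(l_n(\theta))\big]<\inf_{\theta\in\mathfrak{B}_*^\epsilon}\big[-\log(l_n(\theta))\big]\right)\to1.$$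
   Context: $X_1,X_2,\ldots$ are i.i.d. with probability density function $f(\cdot,\theta_0)$ with respect to a $\sigma$-finite measure $\mu$ on $\mathbb{R}^p$, where $\theta_0$ is the true parameter, belonging to the parameter space $\Theta\subset\mathbb{R}^q$, and $\{f(\cdot,\theta)\}_{\theta\in\Theta}$ is a family of densities with respect to $\mu$. The likelihood function is $l_n(\theta)=\prod_{i=1}^nf(X_i,\theta)$. Put $s(\theta,\theta_0)=-\int\log(f(x,\theta))f(x,\theta_0)\,d\mu(x)$. $\mathcal{C}(\Theta)$ denotes the closure of $\Theta$; $\mathcal{C}^*(\Theta)=\mathcal{C}(\Theta)$ if $\Theta$ is bounded and $\mathcal{C}^*(\Theta)=\mathcal{C}(\Theta)\cup\{\infty\}$ otherwise. $B(\theta_0,\epsilon)=\{x\in\mathbb{R}^q:\|x-\theta_0\|\leqslant\epsilon\}$. Under the conditions of the claim, for every $\epsilon>0$ there exists $\delta(\epsilon)>0$ such that $\{\theta\in\Theta:s(\theta,\theta_0)-s(\theta_0,\theta_0)\leqslant\delta(\epsilon)\}\subset B(\theta_0,\epsilon)$; fix such a $\delta(\epsilon)$ and set $B_s(\theta_0,\epsilon)=\{\theta\in\Theta:s(\theta,\theta_0)-s(\theta_0,\theta_0)\leqslant\delta(\epsilon)\}$ and $\mathfrak{A}^\epsilon=B_s(\theta_0,\epsilon)$.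
   Formalization: δ(ε) is additionally required to make B_s(θ_0,ε) compact; without this the claim is false when Θ is not closed. The condition is automatic for closed Θ and holds for all small δ(ε) if Θ is locally compact at θ_0. *)

theory Defs
  imports "HOL-Probability.Probability"
begin

text \<open>
  Densities take values in \<open>[0,\<infinity>]\<close>, so that the condition \<open>0 < f(x,\<theta>) < \<infinity>\<close> defining the
  support is not vacuous in its upper bound. The logarithm is therefore extended by
  \<open>log 0 = -\<infinity>\<close> and \<open>log \<infinity> = \<infinity>\<close>.
\<close>

definition elog :: "ennreal \<Rightarrow> ereal" where
  "elog y = (if y = 0 then -\<infinity> else if y = \<infinity> then \<infinity> else ereal (ln (enn2real y)))"

definition likelihood :: "('x \<Rightarrow> 'v \<Rightarrow> ennreal) \<Rightarrow> (nat \<Rightarrow> 'w \<Rightarrow> 'x) \<Rightarrow> nat \<Rightarrow> 'w \<Rightarrow> 'v \<Rightarrow> ennreal" where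
  "likelihood f X n \<omega> \<theta> = (\<Prod>i<n. f (X i \<omega>) \<theta>)"

text \<open>
  The cross entropy \<open>s(\<theta>,\<theta>')\<close>, as a Bochner integral. If \<open>log (f(x,\<theta>))\<close> is integrable with
  respect to \<open>f(x,\<theta>') d\<mu>(x)\<close> and the two densities have the same support, this is the extended
  Lebesgue integral: where a density is infinite is a \<open>\<mu>\<close>-null set, and where both densities
  vanish the integrand is \<open>0\<close>.
\<close>

definition cross_entropy :: "'x measure \<Rightarrow> ('x \<Rightarrow> 'v \<Rightarrow> ennreal) \<Rightarrow> 'v \<Rightarrow> 'v \<Rightarrow> real" where
  "cross_entropy \<mu> f \<theta> \<theta>' = - (\<integral>x. ln (enn2real (f x \<theta>)) * enn2real (f x \<theta>') \<partial>\<mu>)"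

text \<open>
  \<open>ext_closure \<Theta>\<close> is \<open>\<C>\<^sup>*(\<Theta>)\<close>: finite points are \<open>Some b\<close>, and \<open>None\<close> is the point at infinity.
\<close>

definition ext_closure :: "'v::real_normed_vector set \<Rightarrow> 'v option set" where
  "ext_closure \<Theta> = (if bounded \<Theta> then Some ` closure \<Theta> else insert None (Some ` closure \<Theta>))"

definition ext_nhds :: "'v::real_normed_vector option \<Rightarrow> 'v filter" where
  "ext_nhds b = (case b of Some v \<Rightarrow> nhds v | None \<Rightarrow> at_infinity)"

text \<open>
  The lower limit of \<open>g(x)\<close> as \<open>x\<close> tends to \<open>b\<close> within \<open>\<Theta>\<close>. It is used for \<open>b\<close> outside \<open>\<Theta>\<close>
  only, so there is no question of excluding \<open>b\<close> itself.
\<close>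

definition ext_Liminf ::
    "'v::real_normed_vector set \<Rightarrow> 'v option \<Rightarrow> ('v \<Rightarrow> real) \<Rightarrow> ereal" where
  "ext_Liminf \<Theta> b g = Liminf (inf (ext_nhds b) (principal \<Theta>)) (\<lambda>x. ereal (g x))"

definition entropy_ball ::
    "'x measure \<Rightarrow> ('x \<Rightarrow> 'v \<Rightarrow> ennreal) \<Rightarrow> 'v set \<Rightarrow> 'v \<Rightarrow> real \<Rightarrow> 'v set" where
  "entropy_ball \<mu> f \<Theta> \<theta>\<^sub>0 \<delta> =
     {\<theta> \<in> \<Theta>. cross_entropy \<mu> f \<theta> \<theta>\<^sub>0 - cross_entropy \<mu> f \<theta>\<^sub>0 \<theta>\<^sub>0 \<le> \<delta>}"

text \<open>
  The probability is taken in the completion of \<open>M\<close>: outside the support the values of the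
  densities (\<open>0\<close> or \<open>\<infinity>\<close>) depend on the parameter arbitrarily, so that the event below may
  differ from a measurable one by a non-measurable subset of a null set.
\<close>

definition strongly_separates ::
    "'w measure \<Rightarrow> (nat \<Rightarrow> 'w \<Rightarrow> 'v \<Rightarrow> ereal) \<Rightarrow> 'v set \<Rightarrow> 'v set \<Rightarrow> bool" where
  "strongly_separates M L A B \<longleftrightarrow>
     (\<lambda>n. measure (completion M)
        {\<omega> \<in> space M. (SUP \<theta>\<in>A. L n \<omega> \<theta>) < (INF \<theta>\<in>B. L n \<omega> \<theta>)}) \<longlonglongrightarrow> 1"

text \<open>
  Pitfall: an entropy ball is closed in \<open>\<Theta>\<close>, but \<open>\<Theta>\<close> is an arbitrary set, so an entropy ball
  contained in a Euclidean ball need not be compact. If it is not, the supremum of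
  \<open>-log (l\<^sub>n(\<theta>))\<close> over it may be infinite almost surely for all \<open>n > 0\<close>, although the
  integrability condition on compact subsets of \<open>\<Theta>\<close> holds. The radius of an entropy ball used
  for separation therefore has to be chosen such that the entropy ball is compact.
\<close>

end

theory Submission
  imports Defs
begin

text \<open>
  Up to the factor \<open>n\<close>, the negative log-likelihood is an empirical mean of i.i.d. terms
  \<open>u(X\<^sub>i,\<theta>) = - log f(X\<^sub>i,\<theta>)\<close> with expectation \<open>s(\<theta>,\<theta>\<^sub>0)\<close>. On the entropy ball this expectation
  is at most \<open>s(\<theta>\<^sub>0,\<theta>\<^sub>0) + \<delta>\<close>; on the compact set \<open>B\<close> it attains its minimum, which is therefore
  strictly larger. So there is room for two levels \<open>c\<^sub>1 < c\<^sub>2\<close> in between, and it suffices that with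
  probability tending to one the empirical means stay below \<open>c\<^sub>1\<close> uniformly on the entropy ball and
  above \<open>c\<^sub>2\<close> uniformly on \<open>B\<close>.

  Both are instances of one uniform one-sided weak law of large numbers,
  \<open>uniform_iid_average_below_with_high_probability\<close>, applied to \<open>u\<close> and to \<open>-u\<close>. Its proof is Wald's
  compactness argument. Near each parameter, \<open>u(x,\<cdot>)\<close> is bounded by its supremum over a small ball,
  and by dominated convergence the expectation of this supremum is still below the level if the ball
  is small enough. Finitely many balls cover the compact set, and for each of the finitely
  many suprema the ordinary weak law applies. That law holds under mere integrability: truncation
  leaves a bounded part, for which Hoeffding's inequality is available, and a remainder of
  small expectation, for which Markov's inequality suffices.

  What remains is measurability: almost surely all observations lie in the support, and then the
  loss is continuous in the parameter, so that the supremum and the infimum in the separation event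
  may be taken over countable dense subsets. Hence the event is measurable in the completion.
\<close>

section \<open>A one-sided weak law of large numbers\<close>

lemma (in prob_space) bounded_average_below_with_high_probability:
  fixes Y :: "nat \<Rightarrow> 'a \<Rightarrow> real"
  assumes indep: "indep_vars (\<lambda>_. borel) Y UNIV"
    and same: "\<And>i. distr M borel (Y i) = distr M borel (Y 0)"
    and bound: "\<And>\<omega>. \<omega> \<in> space M \<Longrightarrow> \<bar>Y 0 \<omega>\<bar> \<le> C"
    and c: "expectation (Y 0) < c"
  shows "(\<lambda>n. prob {\<omega>\<in>space M. real n * c \<le> (\<Sum>i<n. Y i \<omega>)}) \<longlonglongrightarrow> 0"
proof (rule tendsto_sandwich[where f="\<lambda>_. 0"])
  define d where "d = c - expectation (Y 0)"
  define K where "K = max C 1"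
  have d: "d > 0" and K: "K > 0" using c by (auto simp: d_def K_def)
  have rv: "random_variable borel (Y i)" for i
    using indep by (auto simp: indep_vars_def)
  show "\<forall>\<^sub>F n in sequentially. prob {\<omega>\<in>space M. real n * c \<le> (\<Sum>i<n. Y i \<omega>)}
          \<le> exp (- 2 * real n * d\<^sup>2 / (K - - K)\<^sup>2)"
    using eventually_gt_at_top[of 0]
  proof eventually_elim
    fix n :: nat assume n: "0 < n"
    have H: "Hoeffding_ineq_iid M {..<n} Y (Y 0) (- K) K"
    proof (unfold_locales)
      show "indep_vars (\<lambda>_. borel) Y {..<n}"
        using indep by (rule indep_vars_subset) auto
      show "AE x in M. Y 0 x \<in> {- K..K}"
        using bound by (intro AE_I2) (fastforce simp: K_def abs_le_iff)
      show "distr M borel (Y i) = distr M borel (Y 0)" for i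
        by (rule same)
    qed (simp_all add: rv)
    have "{\<omega>\<in>space M. real n * c \<le> (\<Sum>i<n. Y i \<omega>)}
        = {\<omega>\<in>space M. expectation (Y 0) + d \<le> (\<Sum>i<n. Y i \<omega>) / card {..<n}}"
      using n by (auto simp: d_def field_simps)
    then show "prob {\<omega>\<in>space M. real n * c \<le> (\<Sum>i<n. Y i \<omega>)}
        \<le> exp (- 2 * real n * d\<^sup>2 / (K - - K)\<^sup>2)"
      using Hoeffding_ineq_iid.Hoeffding_ineq_ge'[OF H, of d] d K n by auto
  qed
  have "(\<lambda>n. exp (- (2 * d\<^sup>2 / (K - - K)\<^sup>2)) ^ n) \<longlonglongrightarrow> 0"
    using d K by (intro LIMSEQ_realpow_zero) (auto intro!: divide_pos_pos)
  then show "(\<lambda>n. exp (- 2 * real n * d\<^sup>2 / (K - - K)\<^sup>2)) \<longlonglongrightarrow> 0"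
    unfolding exp_of_nat_mult[symmetric] by (simp add: mult.assoc mult.left_commute)
qed auto

lemma (in prob_space) sum_average_Markov:
  fixes R :: "nat \<Rightarrow> 'a \<Rightarrow> real"
  assumes int: "\<And>i. integrable M (R i)" and nonneg: "\<And>i \<omega>. 0 \<le> R i \<omega>"
    and mean: "\<And>i. expectation (R i) = m" and "0 < a" "0 < n"
  shows "prob {\<omega>\<in>space M. real n * a \<le> (\<Sum>i<n. R i \<omega>)} \<le> m / a"
proof -
  have "prob {\<omega>\<in>space M. real n * a \<le> (\<Sum>i<n. R i \<omega>)} \<le> expectation (\<lambda>\<omega>. \<Sum>i<n. R i \<omega>) / (n * a)"
    using assms by (intro integral_Markov_inequality_measure[where A="{}"])
      (auto intro!: sum_nonneg)
  also have "\<dots> = m / a"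
    using assms by simp
  finally show ?thesis .
qed

text \<open>
  No second moment is assumed, so Chebyshev's inequality is not applicable to \<open>Y\<close> itself.
  Truncating at level \<open>k\<close> splits \<open>Y\<^sub>i \<le> U\<^sub>i + R\<^sub>i\<close> into a bounded part, whose averages concentrate
  exponentially fast, and a nonnegative remainder whose mean tends to zero as \<open>k\<close> grows; the level \<open>k\<close>
  is chosen once for each prescribed error probability, before \<open>n\<close> tends to infinity.
\<close>

lemma (in prob_space) iid_average_below_with_high_probability:
  fixes Y :: "nat \<Rightarrow> 'a \<Rightarrow> real"
  assumes indep: "indep_vars (\<lambda>_. borel) Y UNIV"
    and same: "\<And>i. distr M borel (Y i) = distr M borel (Y 0)"
    and int: "integrable M (Y 0)"
    and c: "expectation (Y 0) < c"
  shows "(\<lambda>n. prob {\<omega>\<in>space M. (\<Sum>i<n. Y i \<omega>) \<le> real n * c}) \<longlonglongrightarrow> 1"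
proof -
  define d where "d = c - expectation (Y 0)"
  have d: "d > 0" using c by (simp add: d_def)
  have rv[measurable]: "random_variable borel (Y i)" for i
    using indep by (auto simp: indep_vars_def)
  define T :: "nat \<Rightarrow> real \<Rightarrow> real" where "T k y = (if \<bar>y\<bar> \<le> real k then y else 0)" for k y
  have T[measurable]: "T k \<in> borel_measurable borel" for k
    unfolding T_def by measurable
  define \<rho> where "\<rho> k = expectation (\<lambda>\<omega>. \<bar>Y 0 \<omega> - T k (Y 0 \<omega>)\<bar>)" for k
  \<comment> \<open>Dominated convergence: for fixed \<open>\<omega>\<close> the remainder is eventually zero.\<close>
  have "\<rho> \<longlonglongrightarrow> expectation (\<lambda>\<omega>. 0)"
    unfolding \<rho>_def
  proof (rule integral_dominated_convergence)
    show "AE \<omega> in M. (\<lambda>k. \<bar>Y 0 \<omega> - T k (Y 0 \<omega>)\<bar>) \<longlonglongrightarrow> 0"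
    proof (intro AE_I2 tendsto_eventually)
      fix \<omega>
      show "\<forall>\<^sub>F k in sequentially. \<bar>Y 0 \<omega> - T k (Y 0 \<omega>)\<bar> = 0"
        using eventually_ge_at_top[of "nat \<lceil>\<bar>Y 0 \<omega>\<bar>\<rceil>"]
        by eventually_elim (auto simp: T_def nat_ceiling_le_eq)
    qed
    show "integrable M (\<lambda>\<omega>. \<bar>Y 0 \<omega>\<bar>)" using int by simp
  qed (auto simp: T_def)
  then have \<rho>: "\<rho> \<longlonglongrightarrow> 0" by simp
  have "(\<lambda>n. prob {\<omega>\<in>space M. real n * c < (\<Sum>i<n. Y i \<omega>)}) \<longlonglongrightarrow> 0"
  proof (rule order_tendstoI)
    fix e :: real assume e: "0 < e"
    \<comment> \<open>The gap \<open>d\<close> is shared equally by the two parts. The first bound keeps the mean of the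
      truncated part below \<open>c - d/2\<close>, the second makes Markov's bound for the remainder less
      than \<open>e/2\<close>.\<close>
    have "0 < min (d/4) (e * d / 8)" using d e by simp
    with order_tendstoD(2)[OF \<rho> this] obtain k where k: "\<rho> k < d / 4" "\<rho> k < e * d / 8"
      by (auto simp: eventually_sequentially)
    define U where "U i \<omega> = T k (Y i \<omega>)" for i \<omega>
    define R where "R i \<omega> = \<bar>Y i \<omega> - T k (Y i \<omega>)\<bar>" for i \<omega>
    have [measurable]: "random_variable borel (U i)" "random_variable borel (R i)" for i
      unfolding U_def R_def by measurable
    have intU: "integrable M (U 0)"
      by (rule Bochner_Integration.integrable_bound[OF int]) (auto simp: U_def T_def)
    have intR: "integrable M (R i)" and meanR: "expectation (R i) = \<rho> k" for i
    proof -
      have "integrable M (R 0)"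
        using int intU unfolding R_def U_def
        by (intro integrable_abs Bochner_Integration.integrable_diff)
      then have "integrable (distr M borel (Y 0)) (\<lambda>y. \<bar>y - T k y\<bar>)"
        by (subst integrable_distr_eq) (auto simp: R_def[abs_def])
      then have "integrable (distr M borel (Y i)) (\<lambda>y. \<bar>y - T k y\<bar>)"
        by (simp add: same[of i])
      then show "integrable M (R i)"
        by (subst (asm) integrable_distr_eq) (auto simp: R_def[abs_def])
      have "expectation (R i) = (\<integral>y. \<bar>y - T k y\<bar> \<partial>distr M borel (Y i))"
        by (subst integral_distr) (auto simp: R_def[abs_def])
      also have "\<dots> = (\<integral>y. \<bar>y - T k y\<bar> \<partial>distr M borel (Y 0))"
        by (simp add: same[of i])
      also have "\<dots> = \<rho> k"
        by (subst integral_distr) (auto simp: \<rho>_def)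
      finally show "expectation (R i) = \<rho> k" .
    qed
    have "expectation (U 0) \<le> expectation (\<lambda>\<omega>. Y 0 \<omega> + R 0 \<omega>)"
      by (intro integral_mono Bochner_Integration.integrable_add int intU intR)
        (simp add: U_def R_def)
    also have "\<dots> = expectation (Y 0) + \<rho> k"
      using int intR meanR by simp
    finally have meanU: "expectation (U 0) < c - d / 2"
      using k d by (simp add: d_def field_simps)
    have "(\<lambda>n. prob {\<omega>\<in>space M. real n * (c - d / 2) \<le> (\<Sum>i<n. U i \<omega>)}) \<longlonglongrightarrow> 0"
    proof (rule bounded_average_below_with_high_probability[where C="real k"])
      show "indep_vars (\<lambda>_. borel) U UNIV"
        unfolding U_def by (rule indep_vars_compose2[OF indep]) auto
      show "distr M borel (U i) = distr M borel (U 0)" for i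
      proof -
        have "distr M borel (U i) = distr (distr M borel (Y i)) borel (T k)" for i
          by (subst distr_distr) (auto simp: U_def[abs_def] comp_def)
        then show ?thesis by (simp add: same[of i])
      qed
      show "expectation (U 0) < c - d / 2"
        by (rule meanU)
    qed (simp add: U_def T_def)
    from order_tendstoD(2)[OF this, of "e / 2"] e
    have "\<forall>\<^sub>F n in sequentially. prob {\<omega>\<in>space M. real n * (c - d / 2) \<le> (\<Sum>i<n. U i \<omega>)} < e / 2"
      by simp
    then show "\<forall>\<^sub>F n in sequentially. prob {\<omega>\<in>space M. real n * c < (\<Sum>i<n. Y i \<omega>)} < e"
      using eventually_gt_at_top[of 0]
    proof eventually_elim
      fix n :: nat
      assume n: "0 < n" and Un: "prob {\<omega>\<in>space M. real n * (c - d / 2) \<le> (\<Sum>i<n. U i \<omega>)} < e / 2"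
      have "prob {\<omega>\<in>space M. real n * c < (\<Sum>i<n. Y i \<omega>)}
          \<le> prob ({\<omega>\<in>space M. real n * (c - d / 2) \<le> (\<Sum>i<n. U i \<omega>)}
              \<union> {\<omega>\<in>space M. real n * (d / 2) \<le> (\<Sum>i<n. R i \<omega>)})"
      proof (intro finite_measure_mono subsetI)
        fix \<omega> assume \<omega>: "\<omega> \<in> {\<omega>\<in>space M. real n * c < (\<Sum>i<n. Y i \<omega>)}"
        have "(\<Sum>i<n. Y i \<omega>) \<le> (\<Sum>i<n. U i \<omega> + R i \<omega>)"
          by (intro sum_mono) (auto simp: U_def R_def)
        then have "(\<Sum>i<n. Y i \<omega>) \<le> (\<Sum>i<n. U i \<omega>) + (\<Sum>i<n. R i \<omega>)"
          by (simp add: sum.distrib)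
        then show "\<omega> \<in> {\<omega>\<in>space M. real n * (c - d / 2) \<le> (\<Sum>i<n. U i \<omega>)}
              \<union> {\<omega>\<in>space M. real n * (d / 2) \<le> (\<Sum>i<n. R i \<omega>)}"
          using \<omega> by (auto simp: algebra_simps)
      qed measurable
      also have "\<dots> \<le> prob {\<omega>\<in>space M. real n * (c - d / 2) \<le> (\<Sum>i<n. U i \<omega>)}
              + prob {\<omega>\<in>space M. real n * (d / 2) \<le> (\<Sum>i<n. R i \<omega>)}"
        by (intro measure_Un_le) auto
      also have "prob {\<omega>\<in>space M. real n * (d / 2) \<le> (\<Sum>i<n. R i \<omega>)} \<le> \<rho> k / (d / 2)"
        using intR meanR d n by (intro sum_average_Markov) (auto simp: R_def[abs_def])
      also have "\<rho> k / (d / 2) < e / 2"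
        using k mult_pos_pos[OF d e] d by (simp add: field_simps)
      finally show "prob {\<omega>\<in>space M. real n * c < (\<Sum>i<n. Y i \<omega>)} < e"
        using Un by simp
    qed
  qed (intro always_eventually allI, erule less_le_trans, rule measure_nonneg)
  then have "(\<lambda>n. 1 - prob {\<omega>\<in>space M. real n * c < (\<Sum>i<n. Y i \<omega>)}) \<longlonglongrightarrow> 1 - 0"
    by (intro tendsto_diff tendsto_const)
  moreover have "prob {\<omega>\<in>space M. (\<Sum>i<n. Y i \<omega>) \<le> real n * c}
      = 1 - prob {\<omega>\<in>space M. real n * c < (\<Sum>i<n. Y i \<omega>)}" for n
    by (subst prob_compl[symmetric]) (auto intro!: arg_cong[where f=prob])
  ultimately show ?thesis by simp
qed

lemma (in prob_space) high_probability_Int: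
  assumes "\<And>n::nat. E n \<in> events" "\<And>n. F n \<in> events"
    and "(\<lambda>n. prob (E n)) \<longlonglongrightarrow> 1" "(\<lambda>n. prob (F n)) \<longlonglongrightarrow> 1"
  shows "(\<lambda>n. prob (E n \<inter> F n)) \<longlonglongrightarrow> 1"
proof (rule tendsto_sandwich)
  show "(\<lambda>n. prob (E n) + prob (F n) - 1) \<longlonglongrightarrow> 1"
    using tendsto_diff[OF tendsto_add[OF assms(3,4)] tendsto_const[of 1]] by simp
  show "\<forall>\<^sub>F n in sequentially. prob (E n) + prob (F n) - 1 \<le> prob (E n \<inter> F n)"
  proof (rule always_eventually, rule allI)
    fix n
    have "prob (E n \<union> F n) = prob (E n) + prob (F n) - prob (E n \<inter> F n)"
      using assms by (intro measure_Un3) (auto simp: fmeasurable_eq_sets)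
    then show "prob (E n) + prob (F n) - 1 \<le> prob (E n \<inter> F n)"
      using prob_le_1[of "E n \<union> F n"] by linarith
  qed
qed auto

lemma (in prob_space) high_probability_finite_Inter:
  assumes "finite I" "\<And>i n. i \<in> I \<Longrightarrow> E i n \<in> events"
    and "\<And>i. i \<in> I \<Longrightarrow> (\<lambda>n::nat. prob (E i n)) \<longlonglongrightarrow> 1"
  shows "(\<lambda>n. prob (space M \<inter> (\<Inter>i\<in>I. E i n))) \<longlonglongrightarrow> 1"
  using assms
proof (induction I rule: finite_induct)
  case empty
  then show ?case by (simp add: prob_space)
next
  case (insert i I)
  have "space M \<inter> (\<Inter>j\<in>insert i I. E j n) = E i n \<inter> (space M \<inter> (\<Inter>j\<in>I. E j n))" for n
    by auto
  moreover have "(\<lambda>n. prob (E i n \<inter> (space M \<inter> (\<Inter>j\<in>I. E j n)))) \<longlonglongrightarrow> 1"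
  proof (rule high_probability_Int)
    show "space M \<inter> (\<Inter>j\<in>I. E j n) \<in> events" for n
      using insert.prems(1) insert.hyps(1) by (cases "I = {}") (auto intro!: sets.Int sets.finite_INT)
  qed (use insert in auto)
  ultimately show ?case by simp
qed

section \<open>Uniformity over a compact parameter set\<close>

lemma countable_dense_subset_compact:
  fixes K :: "'t::{metric_space,second_countable_topology} set"
  assumes "compact K"
  obtains Q where "countable Q" "Q \<subseteq> K" "closure Q = K"
proof -
  obtain Q where Q: "countable Q" "Q \<subseteq> K" "K \<subseteq> closure Q"
    by (rule separable[of K])
  with compact_imp_closed[OF assms] have "closure Q = K"
    by (metis closure_minimal subset_antisym)
  with Q that show ?thesis by blast
qed

text \<open>
  The local step of Wald's argument: as the ball around \<open>\<theta>\<close> shrinks, the supremum of \<open>g x\<close> over it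
  decreases to \<open>g x \<theta>\<close> by continuity, and the integrals follow by dominated convergence. The supremum
  is formed over a countable dense set, which makes it measurable; continuity extends the
  bound from there to all of \<open>K\<close>.
\<close>

lemma local_supremum_integral_below:
  fixes g :: "'b \<Rightarrow> 't::{metric_space,second_countable_topology} \<Rightarrow> real"
  assumes K: "compact K" "\<theta> \<in> K"
    and meas: "\<And>\<theta>. \<theta> \<in> K \<Longrightarrow> (\<lambda>x. g x \<theta>) \<in> borel_measurable D"
    and cont: "\<And>x. x \<in> space D \<Longrightarrow> continuous_on K (g x)"
    and G: "integrable D G"
    and dom: "\<And>x \<theta>. x \<in> space D \<Longrightarrow> \<theta> \<in> K \<Longrightarrow> \<bar>g x \<theta>\<bar> \<le> G x"
    and mean: "(\<integral>x. g x \<theta> \<partial>D) < c"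
  obtains r h where "r > 0" "h \<in> borel_measurable D" "integrable D h" "(\<integral>x. h x \<partial>D) < c"
    "\<And>x \<theta>'. x \<in> space D \<Longrightarrow> \<theta>' \<in> K \<Longrightarrow> \<theta>' \<in> ball \<theta> r \<Longrightarrow> g x \<theta>' \<le> h x"
proof -
  obtain Q where Q: "countable Q" "Q \<subseteq> K" "closure Q = K"
    by (rule countable_dense_subset_compact[OF K(1)])
  define r :: "nat \<Rightarrow> real" where "r k = inverse (real (Suc k))" for k
  define h where "h k x = (SUP \<theta>'\<in>Q \<inter> ball \<theta> (r k). g x \<theta>')" for k x
  have r: "r k > 0" for k by (simp add: r_def)
  have ne: "Q \<inter> ball \<theta> (r k) \<noteq> {}" for k
    using K(2) Q(3) r[of k] closure_approachable[of \<theta> Q] by (fastforce simp: dist_commute)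
  have bdd: "bdd_above (g x ` (Q \<inter> ball \<theta> (r k)))" if "x \<in> space D" for x k
    using dom[OF that] Q(2) by (intro bdd_aboveI2[where M="G x"]) (fastforce simp: abs_le_iff)
  have meas_h: "h k \<in> borel_measurable D" for k
    unfolding h_def using Q bdd meas by (intro borel_measurable_cSUP) auto
  have bound: "\<bar>h k x\<bar> \<le> G x" if x: "x \<in> space D" for k x
  proof -
    obtain q where q: "q \<in> Q \<inter> ball \<theta> (r k)" using ne by blast
    have "g x q \<le> h k x"
      unfolding h_def by (rule cSUP_upper[OF q bdd[OF x]])
    moreover have "- G x \<le> g x q"
      using dom[OF x, of q] q Q(2) by (auto simp: abs_le_iff)
    moreover have "h k x \<le> G x"
      unfolding h_def using dom[OF x] Q(2) by (intro cSUP_least[OF ne]) (fastforce simp: abs_le_iff)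
    ultimately show ?thesis by (simp add: abs_le_iff)
  qed
  have lim: "(\<lambda>k. h k x) \<longlonglongrightarrow> g x \<theta>" if x: "x \<in> space D" for x
  proof (rule LIMSEQ_I)
    fix e :: real assume "0 < e"
    then have e: "0 < e / 2" by simp
    with cont[OF x] K(2) obtain s where s: "s > 0"
      "\<And>\<theta>'. \<theta>' \<in> K \<Longrightarrow> dist \<theta>' \<theta> < s \<Longrightarrow> \<bar>g x \<theta>' - g x \<theta>\<bar> < e / 2"
      unfolding continuous_on_iff dist_real_def by blast
    obtain k0 where k0: "inverse (real (Suc k0)) < s"
      using reals_Archimedean[OF s(1)] by blast
    show "\<exists>k0. \<forall>k\<ge>k0. norm (h k x - g x \<theta>) < e"
    proof (intro exI[of _ k0] allI impI)
      fix k assume "k0 \<le> k"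
      then have "r k \<le> inverse (real (Suc k0))"
        by (simp add: r_def le_imp_inverse_le)
      then have near: "\<bar>g x q - g x \<theta>\<bar> < e / 2" if "q \<in> Q \<inter> ball \<theta> (r k)" for q
        using s(2)[of q] that Q(2) k0 by (auto simp: dist_commute)
      obtain q where q: "q \<in> Q \<inter> ball \<theta> (r k)" using ne by blast
      have "g x q \<le> h k x"
        unfolding h_def by (rule cSUP_upper[OF q bdd[OF x]])
      moreover have "h k x \<le> g x \<theta> + e / 2"
        unfolding h_def
      proof (rule cSUP_least[OF ne])
        fix q assume "q \<in> Q \<inter> ball \<theta> (r k)"
        from near[OF this] show "g x q \<le> g x \<theta> + e / 2" by linarith
      qed
      ultimately show "norm (h k x - g x \<theta>) < e"
        using near[OF q] e unfolding real_norm_def by linarith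
    qed
  qed
  have int: "integrable D (h k)" for k
    by (rule Bochner_Integration.integrable_bound[OF G meas_h])
      (auto intro: order_trans[OF bound abs_ge_self])
  have "(\<lambda>k. \<integral>x. h k x \<partial>D) \<longlonglongrightarrow> (\<integral>x. g x \<theta> \<partial>D)"
    by (rule integral_dominated_convergence[where w=G])
       (use meas[OF K(2)] meas_h G lim bound in auto)
  from order_tendstoD(2)[OF this mean] obtain k where k: "(\<integral>x. h k x \<partial>D) < c"
    by (auto simp: eventually_sequentially)
  show ?thesis
  proof (rule that[OF r meas_h int k])
    fix x \<theta>' assume x: "x \<in> space D" and "\<theta>' \<in> K" "\<theta>' \<in> ball \<theta> (r k)"
    have "continuous_on (closure (ball \<theta> (r k) \<inter> Q)) (g x)"
      by (rule continuous_on_subset[OF cont[OF x]]) (use Q(3) closure_mono in blast)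
    moreover from \<open>\<theta>' \<in> K\<close> \<open>\<theta>' \<in> ball \<theta> (r k)\<close> have "\<theta>' \<in> closure (ball \<theta> (r k) \<inter> Q)"
      using open_Int_closure_subset[OF open_ball, of \<theta> "r k" Q] Q(3) by blast
    moreover have "g x q \<le> h k x" if "q \<in> ball \<theta> (r k) \<inter> Q" for q
      unfolding h_def using that by (intro cSUP_upper bdd[OF x]) auto
    ultimately show "g x \<theta>' \<le> h k x"
      by (rule continuous_le_on_closure)
  qed
qed

text \<open>
  Uniformity costs nothing beyond the ordinary weak law because the bound is one-sided: a majorant
  valid on a whole ball replaces all parameters in it at once, and by compactness finitely many
  balls suffice. A lower bound is obtained by applying the lemma to \<open>-g\<close>. The conclusion is in terms of
  events \<open>E n\<close>, since the set of all \<open>\<omega>\<close> satisfying the uniform bound is not obviously measurable.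
\<close>

lemma (in prob_space) uniform_iid_average_below_with_high_probability:
  fixes X :: "nat \<Rightarrow> 'a \<Rightarrow> 'b"
    and g :: "'b \<Rightarrow> 't::{metric_space,second_countable_topology} \<Rightarrow> real"
  assumes indep: "indep_vars (\<lambda>_. N) X UNIV"
    and same: "\<And>i. distr M N (X i) = distr M N (X 0)"
    and K: "compact K"
    and meas: "\<And>\<theta>. \<theta> \<in> K \<Longrightarrow> (\<lambda>x. g x \<theta>) \<in> borel_measurable N"
    and cont: "\<And>x. x \<in> space N \<Longrightarrow> continuous_on K (g x)"
    and G: "integrable (distr M N (X 0)) G"
    and dom: "\<And>x \<theta>. x \<in> space N \<Longrightarrow> \<theta> \<in> K \<Longrightarrow> \<bar>g x \<theta>\<bar> \<le> G x"
    and mean: "\<And>\<theta>. \<theta> \<in> K \<Longrightarrow> (\<integral>x. g x \<theta> \<partial>distr M N (X 0)) < c"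
  obtains E where "\<And>n. E n \<in> events" "(\<lambda>n. prob (E n)) \<longlonglongrightarrow> 1"
    "\<And>n \<omega> \<theta>. \<omega> \<in> E n \<Longrightarrow> \<theta> \<in> K \<Longrightarrow> (\<Sum>i<n. g (X i \<omega>) \<theta>) \<le> real n * c"
proof -
  let ?D = "distr M N (X 0)"
  have rv[measurable]: "random_variable N (X i)" for i
    using indep by (auto simp: indep_vars_def)
  define local_majorant where "local_majorant \<theta> r h \<longleftrightarrow>
      r > 0 \<and> h \<in> borel_measurable N \<and> integrable ?D h \<and> (\<integral>x. h x \<partial>?D) < c \<and>
      (\<forall>x\<in>space N. \<forall>\<theta>'\<in>K \<inter> ball \<theta> r. g x \<theta>' \<le> h x)" for \<theta> r h
  have "\<exists>r h. local_majorant \<theta> r h" if \<theta>: "\<theta> \<in> K" for \<theta>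
  proof (rule local_supremum_integral_below
      [where D="?D" and g=g, OF K \<theta> _ _ G _ mean[OF \<theta>]])
    show "(\<lambda>x. g x \<theta>) \<in> borel_measurable ?D" if "\<theta> \<in> K" for \<theta>
      using meas[OF that] by simp
    show "continuous_on K (g x)" if "x \<in> space ?D" for x
      using cont that by simp
    show "\<bar>g x \<theta>\<bar> \<le> G x" if "x \<in> space ?D" "\<theta> \<in> K" for x \<theta>
      using dom that by simp
    fix r h
    assume "r > 0" "h \<in> borel_measurable ?D" "integrable ?D h" "(\<integral>x. h x \<partial>?D) < c"
      "\<And>x \<theta>'. x \<in> space ?D \<Longrightarrow> \<theta>' \<in> K \<Longrightarrow> \<theta>' \<in> ball \<theta> r \<Longrightarrow> g x \<theta>' \<le> h x"
    then have "local_majorant \<theta> r h" by (simp add: local_majorant_def)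
    then show "\<exists>r h. local_majorant \<theta> r h" by blast
  qed
  then obtain r h where "\<And>\<theta>. \<theta> \<in> K \<Longrightarrow> local_majorant \<theta> (r \<theta>) (h \<theta>)"
    by metis
  then have rh: "\<And>\<theta>. \<theta> \<in> K \<Longrightarrow> r \<theta> > 0"
      "\<And>\<theta>. \<theta> \<in> K \<Longrightarrow> h \<theta> \<in> borel_measurable N" "\<And>\<theta>. \<theta> \<in> K \<Longrightarrow> integrable ?D (h \<theta>)"
      "\<And>\<theta>. \<theta> \<in> K \<Longrightarrow> (\<integral>x. h \<theta> x \<partial>?D) < c"
      "\<And>\<theta> x \<theta>'. \<theta> \<in> K \<Longrightarrow> x \<in> space N \<Longrightarrow> \<theta>' \<in> K \<Longrightarrow> \<theta>' \<in> ball \<theta> (r \<theta>) \<Longrightarrow> g x \<theta>' \<le> h \<theta> x"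
    unfolding local_majorant_def by blast+
  have "K \<subseteq> (\<Union>\<theta>\<in>K. ball \<theta> (r \<theta>))"
    using rh(1) by force
  from compactE_image[OF K open_ball this]
  obtain T where T: "T \<subseteq> K" "finite T" "K \<subseteq> (\<Union>\<theta>\<in>T. ball \<theta> (r \<theta>))"
    by blast
  define F where "F \<theta> n = {\<omega>\<in>space M. (\<Sum>i<n. h \<theta> (X i \<omega>)) \<le> real n * c}" for \<theta> n
  have F_events: "F \<theta> n \<in> events" if "\<theta> \<in> T" for \<theta> n
  proof -
    have [measurable]: "h \<theta> \<in> borel_measurable N" using rh(2) that T(1) by blast
    show ?thesis unfolding F_def by measurable
  qed
  have F_prob: "(\<lambda>n. prob (F \<theta> n)) \<longlonglongrightarrow> 1" if "\<theta> \<in> T" for \<theta>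
    unfolding F_def
  proof (rule iid_average_below_with_high_probability)
    have \<theta>: "\<theta> \<in> K" using that T(1) by blast
    have [measurable]: "h \<theta> \<in> borel_measurable N" using rh(2) \<theta> by blast
    show "indep_vars (\<lambda>_. borel) (\<lambda>i \<omega>. h \<theta> (X i \<omega>)) UNIV"
      by (rule indep_vars_compose2[OF indep]) auto
    have "distr M borel (\<lambda>\<omega>. h \<theta> (X i \<omega>)) = distr (distr M N (X i)) borel (h \<theta>)" for i
      by (subst distr_distr) (auto simp: comp_def)
    then show "distr M borel (\<lambda>\<omega>. h \<theta> (X i \<omega>)) = distr M borel (\<lambda>\<omega>. h \<theta> (X 0 \<omega>))" for i
      by (simp add: same[of i])
    show "integrable M (\<lambda>\<omega>. h \<theta> (X 0 \<omega>))"
      using rh(3)[OF \<theta>] by (subst (asm) integrable_distr_eq) auto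
    show "expectation (\<lambda>\<omega>. h \<theta> (X 0 \<omega>)) < c"
      using rh(4)[OF \<theta>] by (subst (asm) integral_distr) auto
  qed
  show ?thesis
  proof (rule that)
    show "space M \<inter> (\<Inter>\<theta>\<in>T. F \<theta> n) \<in> events" for n
      using F_events T(2) by (cases "T = {}") (auto intro!: sets.Int sets.finite_INT)
    show "(\<lambda>n. prob (space M \<inter> (\<Inter>\<theta>\<in>T. F \<theta> n))) \<longlonglongrightarrow> 1"
      by (rule high_probability_finite_Inter[OF T(2) F_events F_prob])
    fix n \<omega> \<theta> assume \<omega>: "\<omega> \<in> space M \<inter> (\<Inter>\<theta>\<in>T. F \<theta> n)" and \<theta>: "\<theta> \<in> K"
    obtain t where t: "t \<in> T" "\<theta> \<in> ball t (r t)" using T(3) \<theta> by blast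
    have "X i \<omega> \<in> space N" for i
      using \<omega> measurable_space[OF rv] by blast
    then have "(\<Sum>i<n. g (X i \<omega>) \<theta>) \<le> (\<Sum>i<n. h t (X i \<omega>))"
      using t T(1) \<theta> by (intro sum_mono rh(5)) auto
    also have "\<dots> \<le> real n * c"
      using \<omega> t(1) by (auto simp: F_def)
    finally show "(\<Sum>i<n. g (X i \<omega>) \<theta>) \<le> real n * c" .
  qed
qed

section \<open>The separation event\<close>

lemma SUP_closure_eq:
  assumes cont: "continuous_on (closure Q) h"
  shows "(SUP \<theta>\<in>closure Q. ereal (h \<theta>)) = (SUP \<theta>\<in>Q. ereal (h \<theta>))"
proof (rule antisym)
  show "(SUP \<theta>\<in>Q. ereal (h \<theta>)) \<le> (SUP \<theta>\<in>closure Q. ereal (h \<theta>))"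
    by (rule SUP_subset_mono[OF closure_subset]) simp
  show "(SUP \<theta>\<in>closure Q. ereal (h \<theta>)) \<le> (SUP \<theta>\<in>Q. ereal (h \<theta>))"
  proof (rule SUP_least)
    fix \<theta> assume \<theta>: "\<theta> \<in> closure Q"
    then obtain q where q: "q \<in> Q" by (metis closure_empty empty_iff ex_in_conv)
    show "ereal (h \<theta>) \<le> (SUP \<theta>\<in>Q. ereal (h \<theta>))"
    proof (cases "SUP \<theta>\<in>Q. ereal (h \<theta>)")
      case (real c)
      have "h \<theta> \<le> c"
      proof (rule continuous_le_on_closure[OF cont \<theta>])
        fix q assume "q \<in> Q"
        then have "ereal (h q) \<le> ereal c"
          unfolding real[symmetric] by (rule SUP_upper)
        then show "h q \<le> c" by simp
      qed
      then show ?thesis by (simp add: real)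
    next
      case MInf
      then show ?thesis using SUP_upper[OF q, of "\<lambda>\<theta>. ereal (h \<theta>)"] by simp
    qed simp
  qed
qed

lemma INF_closure_eq:
  assumes cont: "continuous_on (closure Q) h"
  shows "(INF \<theta>\<in>closure Q. ereal (h \<theta>)) = (INF \<theta>\<in>Q. ereal (h \<theta>))"
proof -
  have "(SUP \<theta>\<in>closure Q. - ereal (h \<theta>)) = (SUP \<theta>\<in>Q. - ereal (h \<theta>))"
    using SUP_closure_eq[of Q "\<lambda>\<theta>. - h \<theta>"] cont by (simp add: continuous_on_minus)
  then show ?thesis
    unfolding ereal_SUP_uminus_eq by simp
qed

text \<open>
  The two levels \<open>c1 < c2\<close> separate the losses on \<open>E n\<close>, so the separation event contains \<open>E n\<close> up to a
  null set. Its probability in the completion is meaningful only if it is measurable there. This is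
  why the loss \<open>L\<close> is compared with the continuous, measurable version \<open>l\<close>: off a null set the event
  agrees with the one defined by \<open>l\<close> and countable dense subsets.
\<close>

lemma (in prob_space) strongly_separates_if_bounded_apart:
  fixes l :: "nat \<Rightarrow> 'a \<Rightarrow> 't::{metric_space,second_countable_topology} \<Rightarrow> real"
  assumes A: "compact A" and B: "compact B"
    and meas: "\<And>n \<theta>. \<theta> \<in> A \<union> B \<Longrightarrow> (\<lambda>\<omega>. l n \<omega> \<theta>) \<in> borel_measurable M"
    and cont: "\<And>n \<omega>. \<omega> \<in> space M \<Longrightarrow> continuous_on (A \<union> B) (l n \<omega>)"
    and eq: "AE \<omega> in M. \<forall>n. \<forall>\<theta>\<in>A \<union> B. L n \<omega> \<theta> = ereal (l n \<omega> \<theta>)"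
    and E: "\<And>n. E n \<in> events" "(\<lambda>n. prob (E n)) \<longlonglongrightarrow> 1"
    and EA: "\<And>n \<omega> \<theta>. \<omega> \<in> E n \<Longrightarrow> \<theta> \<in> A \<Longrightarrow> l n \<omega> \<theta> \<le> real n * c1"
    and EB: "\<And>n \<omega> \<theta>. \<omega> \<in> E n \<Longrightarrow> \<theta> \<in> B \<Longrightarrow> real n * c2 \<le> l n \<omega> \<theta>"
    and c: "c1 < c2"
  shows "strongly_separates M L A B"
proof -
  obtain QA where QA: "countable QA" "QA \<subseteq> A" "closure QA = A"
    by (rule countable_dense_subset_compact[OF A])
  obtain QB where QB: "countable QB" "QB \<subseteq> B" "closure QB = B"
    by (rule countable_dense_subset_compact[OF B])
  obtain N where N: "N \<in> null_sets M"
    "\<And>n \<omega> \<theta>. \<omega> \<in> space M - N \<Longrightarrow> \<theta> \<in> A \<union> B \<Longrightarrow> L n \<omega> \<theta> = ereal (l n \<omega> \<theta>)"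
    using eq by (auto elim!: AE_E3)
  define V where "V n = {\<omega>\<in>space M. (SUP \<theta>\<in>A. L n \<omega> \<theta>) < (INF \<theta>\<in>B. L n \<omega> \<theta>)}" for n
  define W where "W n = {\<omega>\<in>space M. (SUP \<theta>\<in>QA. ereal (l n \<omega> \<theta>)) < (INF \<theta>\<in>QB. ereal (l n \<omega> \<theta>))}"
    for n
  have W: "W n \<in> events" for n
  proof -
    have [measurable]: "(\<lambda>\<omega>. SUP \<theta>\<in>QA. ereal (l n \<omega> \<theta>)) \<in> borel_measurable M"
      "(\<lambda>\<omega>. INF \<theta>\<in>QB. ereal (l n \<omega> \<theta>)) \<in> borel_measurable M"
      using QA QB by (auto intro!: borel_measurable_SUP borel_measurable_INF borel_measurable_ereal meas)
    show ?thesis unfolding W_def by measurable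
  qed
  have VW: "\<omega> \<in> V n \<longleftrightarrow> \<omega> \<in> W n" if \<omega>: "\<omega> \<in> space M - N" for n \<omega>
  proof -
    have "(SUP \<theta>\<in>A. L n \<omega> \<theta>) = (SUP \<theta>\<in>A. ereal (l n \<omega> \<theta>))"
      by (intro SUP_cong refl N(2) \<omega>) auto
    also have "\<dots> = (SUP \<theta>\<in>QA. ereal (l n \<omega> \<theta>))"
      using SUP_closure_eq[of QA "l n \<omega>"] cont[of \<omega> n] \<omega> QA(3) by (auto intro: continuous_on_subset)
    finally have *: "(SUP \<theta>\<in>A. L n \<omega> \<theta>) = (SUP \<theta>\<in>QA. ereal (l n \<omega> \<theta>))" .
    have "(INF \<theta>\<in>B. L n \<omega> \<theta>) = (INF \<theta>\<in>B. ereal (l n \<omega> \<theta>))"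
      by (intro INF_cong refl N(2) \<omega>) auto
    also have "\<dots> = (INF \<theta>\<in>QB. ereal (l n \<omega> \<theta>))"
      using INF_closure_eq[of QB "l n \<omega>"] cont[of \<omega> n] \<omega> QB(3) by (auto intro: continuous_on_subset)
    finally show ?thesis
      using * \<omega> by (simp add: V_def W_def)
  qed
  have V: "V n \<in> sets (completion M)" for n
  proof (rule sets_completionI)
    show "V n = (W n - N) \<union> (V n \<inter> N)"
      using VW by (auto simp: V_def W_def)
  qed (use N(1) W in auto)
  interpret completion: prob_space "completion M"
    by (rule prob_space_completion)
  have "(\<lambda>n. measure (completion M) (V n)) \<longlonglongrightarrow> 1"
  proof (rule tendsto_sandwich[OF _ _ E(2) tendsto_const])
    \<comment> \<open>For \<open>n = 0\<close> the two bounds \<open>n * c1\<close> and \<open>n * c2\<close> coincide.\<close>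
    show "\<forall>\<^sub>F n in sequentially. prob (E n) \<le> measure (completion M) (V n)"
      using eventually_gt_at_top[of 0]
    proof eventually_elim
      fix n :: nat assume n: "0 < n"
      have "E n - N \<subseteq> V n"
      proof
        fix \<omega> assume \<omega>: "\<omega> \<in> E n - N"
        then have \<omega>': "\<omega> \<in> space M - N" using sets.sets_into_space[OF E(1)] by blast
        have "(SUP \<theta>\<in>A. L n \<omega> \<theta>) \<le> ereal (real n * c1)"
          using \<omega> EA N(2)[OF \<omega>'] by (intro SUP_least) auto
        also have "\<dots> < ereal (real n * c2)"
          using c n by simp
        also have "\<dots> \<le> (INF \<theta>\<in>B. L n \<omega> \<theta>)"
          using \<omega> EB N(2)[OF \<omega>'] by (intro INF_greatest) auto
        finally show "\<omega> \<in> V n" using \<omega>' by (simp add: V_def)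
      qed
      then have "measure (completion M) (E n - N) \<le> measure (completion M) (V n)"
        by (rule completion.finite_measure_mono[OF _ V])
      moreover have "measure (completion M) (E n - N) = prob (E n)"
        using N(1) E(1)[of n] measure_completion[of "E n - N" M]
        by (metis measure_Diff_null_set null_setsD2 sets.Diff)
      ultimately show "prob (E n) \<le> measure (completion M) (V n)" by simp
    qed
  qed simp
  then show ?thesis
    unfolding strongly_separates_def V_def .
qed

section \<open>Separation by the likelihood\<close>

lemma elog_ennreal: "0 < r \<Longrightarrow> elog (ennreal r) = ereal (ln r)"
  by (simp add: elog_def)

lemma neg_elog_likelihood:
  assumes "\<And>i. i < n \<Longrightarrow> 0 < f (X i \<omega>) \<theta> \<and> f (X i \<omega>) \<theta> < \<infinity>"
  shows "- elog (likelihood f X n \<omega> \<theta>) = ereal (\<Sum>i<n. - ln (enn2real (f (X i \<omega>) \<theta>)))"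
proof -
  have pos: "0 < enn2real (f (X i \<omega>) \<theta>)" if "i < n" for i
    using assms[OF that] by (simp add: enn2real_positive_iff)
  have "likelihood f X n \<omega> \<theta> = (\<Prod>i<n. ennreal (enn2real (f (X i \<omega>) \<theta>)))"
    unfolding likelihood_def using assms by (intro prod.cong) auto
  also have "\<dots> = ennreal (\<Prod>i<n. enn2real (f (X i \<omega>) \<theta>))"
    by (rule prod_ennreal) simp
  moreover have "0 < (\<Prod>i<n. enn2real (f (X i \<omega>) \<theta>))"
    using pos by (intro prod_pos) auto
  ultimately have "elog (likelihood f X n \<omega> \<theta>) = ereal (ln (\<Prod>i<n. enn2real (f (X i \<omega>) \<theta>)))"
    by (simp add: elog_ennreal)
  also have "ln (\<Prod>i<n. enn2real (f (X i \<omega>) \<theta>)) = (\<Sum>i<n. ln (enn2real (f (X i \<omega>) \<theta>)))"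
    using pos by (intro ln_prod) (auto simp: less_imp_neq[symmetric])
  finally show ?thesis by (simp add: sum_negf)
qed

theorem theorem4p2:
  fixes M :: "'w measure"
    and \<mu> :: "(real ^ 'p) measure"
    and \<Theta> :: "(real ^ 'q) set"
    and f :: "real ^ 'p \<Rightarrow> real ^ 'q \<Rightarrow> ennreal"
    and X :: "nat \<Rightarrow> 'w \<Rightarrow> real ^ 'p"
    and \<theta>\<^sub>0 :: "real ^ 'q"
    and S :: "(real ^ 'p) set"
    and \<epsilon> \<delta> :: real
    and B :: "(real ^ 'q) set"
  assumes "prob_space M"
    and "sigma_finite_measure \<mu>" and "sets \<mu> = sets borel"
    and density_measurable: "\<And>\<theta>. \<theta> \<in> \<Theta> \<Longrightarrow> (\<lambda>x. f x \<theta>) \<in> borel_measurable \<mu>"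
    and density_integral: "\<And>\<theta>. \<theta> \<in> \<Theta> \<Longrightarrow> (\<integral>\<^sup>+x. f x \<theta> \<partial>\<mu>) = 1"
    and true_parameter: "\<theta>\<^sub>0 \<in> \<Theta>"
    and independent: "prob_space.indep_vars M (\<lambda>_. borel) X UNIV"
    and identically_distributed: "\<And>i. distributed M \<mu> (X i) (\<lambda>x. f x \<theta>\<^sub>0)"
    and identifiable: "\<And>\<theta>\<^sub>1 \<theta>\<^sub>2. \<theta>\<^sub>1 \<in> \<Theta> \<Longrightarrow> \<theta>\<^sub>2 \<in> \<Theta> \<Longrightarrow> (AE x in \<mu>. f x \<theta>\<^sub>1 = f x \<theta>\<^sub>2) \<Longrightarrow> \<theta>\<^sub>1 = \<theta>\<^sub>2"
    and entropy_continuous: "\<And>\<theta>'. \<theta>' \<in> \<Theta> \<Longrightarrow> continuous_on \<Theta> (\<lambda>\<theta>. cross_entropy \<mu> f \<theta> \<theta>')"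
    and entropy_boundary: "\<And>\<theta>' b. \<theta>' \<in> \<Theta> \<Longrightarrow> b \<in> ext_closure \<Theta> - Some ` \<Theta> \<Longrightarrow>
      ext_Liminf \<Theta> b (\<lambda>\<theta>. cross_entropy \<mu> f \<theta> \<theta>') > ereal (cross_entropy \<mu> f \<theta>' \<theta>')"
    and common_support: "\<And>\<theta>. \<theta> \<in> \<Theta> \<Longrightarrow> {x. 0 < f x \<theta> \<and> f x \<theta> < \<infinity>} = S"
    and density_continuous: "\<And>x. x \<in> S \<Longrightarrow> continuous_on \<Theta> (f x)"
    and locally_dominated: "\<And>\<theta> K. \<theta> \<in> \<Theta> \<Longrightarrow> compact K \<Longrightarrow> K \<subseteq> \<Theta> \<Longrightarrow>
      (\<integral>\<^sup>+x. (SUP \<phi>\<in>K. e2ennreal \<bar>elog (f x \<phi>)\<bar>) * f x \<theta> \<partial>\<mu>) < \<infinity>"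
    and "\<epsilon> > 0" and "\<delta> > 0"
    and ball_subset: "entropy_ball \<mu> f \<Theta> \<theta>\<^sub>0 \<delta> \<subseteq> cball \<theta>\<^sub>0 \<epsilon>"
    and ball_compact: "compact (entropy_ball \<mu> f \<Theta> \<theta>\<^sub>0 \<delta>)"
    and "compact B" and "B \<subseteq> \<Theta> - entropy_ball \<mu> f \<Theta> \<theta>\<^sub>0 \<delta>"
  shows "strongly_separates M (\<lambda>n \<omega> \<theta>. - elog (likelihood f X n \<omega> \<theta>))
           (entropy_ball \<mu> f \<Theta> \<theta>\<^sub>0 \<delta>) B"
proof -
  interpret prob_space M by fact
  define A where "A = entropy_ball \<mu> f \<Theta> \<theta>\<^sub>0 \<delta>"
  define s where "s \<theta> = cross_entropy \<mu> f \<theta> \<theta>\<^sub>0" for \<theta>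
  define K where "K = A \<union> B"
  define D where "D = distr M \<mu> (X 0)"
  \<comment> \<open>Setting the loss to zero off the support makes it continuous in the parameter for every
    observation, and changes nothing almost surely.\<close>
  define u where "u x \<theta> = (if x \<in> S then - ln (enn2real (f x \<theta>)) else 0)" for x \<theta>
  have A: "compact A" and A_sub: "A \<subseteq> \<Theta>"
    using ball_compact by (auto simp: A_def entropy_ball_def)
  have K: "compact K" and K_sub: "K \<subseteq> \<Theta>"
    using A A_sub assms by (auto simp: K_def)
  have space_\<mu>: "space \<mu> = UNIV"
    using sets_eq_imp_space_eq[OF \<open>sets \<mu> = sets borel\<close>] by simp
  have S_iff: "x \<in> S \<longleftrightarrow> 0 < f x \<theta> \<and> f x \<theta> < \<infinity>" if "\<theta> \<in> \<Theta>" for x \<theta>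
    using common_support[OF that] by blast
  have f0[measurable]: "(\<lambda>x. f x \<theta>\<^sub>0) \<in> borel_measurable \<mu>"
    by (rule density_measurable[OF true_parameter])
  have S[measurable]: "S \<in> sets \<mu>"
  proof -
    have "{x\<in>space \<mu>. 0 < f x \<theta>\<^sub>0 \<and> f x \<theta>\<^sub>0 < \<infinity>} \<in> sets \<mu>"
      by measurable
    then show ?thesis
      unfolding space_\<mu> using common_support[OF true_parameter] by simp
  qed
  have rv[measurable]: "random_variable \<mu> (X i)" for i
    using identically_distributed by (rule distributed_measurable)
  have indep: "indep_vars (\<lambda>_. \<mu>) X UNIV"
    using indep_vars_compose2[OF independent, of "\<lambda>_ x. x" "\<lambda>_. \<mu>"] \<open>sets \<mu> = sets borel\<close>
    by (simp add: measurable_ident_sets)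
  have law: "distr M \<mu> (X i) = density \<mu> (\<lambda>x. f x \<theta>\<^sub>0)" for i
    using identically_distributed by (rule distributed_distr_eq_density)
  have same: "distr M \<mu> (X i) = distr M \<mu> (X 0)" for i
    by (simp only: law)
  have finite: "AE x in \<mu>. f x \<theta>\<^sub>0 < \<infinity>"
    using nn_integral_PInf_AE[OF f0] density_integral[OF true_parameter]
    by (simp add: less_top[symmetric])
  have law_real: "D = density \<mu> (\<lambda>x. ennreal (enn2real (f x \<theta>\<^sub>0)))"
    unfolding D_def law using finite by (intro density_cong) auto

  have u_meas: "(\<lambda>x. u x \<theta>) \<in> borel_measurable \<mu>" if "\<theta> \<in> \<Theta>" for \<theta>
  proof -
    have [measurable]: "(\<lambda>x. f x \<theta>) \<in> borel_measurable \<mu>" by (rule density_measurable[OF that])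
    show ?thesis unfolding u_def by measurable
  qed
  have u_cont: "continuous_on K (u x)" for x
  proof (cases "x \<in> S")
    case True
    have "continuous_on K (\<lambda>\<theta>. - ln (enn2real (f x \<theta>)))"
      unfolding continuous_on_def
    proof
      fix \<theta> assume \<theta>: "\<theta> \<in> K"
      then have pos: "0 < f x \<theta>" "f x \<theta> < top"
        using S_iff K_sub True by auto
      have "(f x \<longlongrightarrow> f x \<theta>) (at \<theta> within K)"
        using continuous_on_subset[OF density_continuous[OF True] K_sub] \<theta>
        by (auto simp: continuous_on_def)
      then have "((\<lambda>\<phi>. enn2real (f x \<phi>)) \<longlongrightarrow> enn2real (f x \<theta>)) (at \<theta> within K)"
        using pos by (intro tendsto_enn2real) auto
      then show "((\<lambda>\<phi>. - ln (enn2real (f x \<phi>))) \<longlongrightarrow> - ln (enn2real (f x \<theta>))) (at \<theta> within K)"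
        using pos enn2real_positive_iff[of "f x \<theta>"]
        by (intro tendsto_minus tendsto_ln) auto
    qed
    with True show ?thesis by (simp add: u_def)
  next
    case False
    then show ?thesis by (simp add: u_def)
  qed
  \<comment> \<open>The density may be infinite on a null set, so the law is rewritten with a real density first.
    Off the support the real density is zero, so the two integrands agree everywhere.\<close>
  have u_mean: "(\<integral>x. u x \<theta> \<partial>D) = s \<theta>" if "\<theta> \<in> \<Theta>" for \<theta>
  proof -
    have "(\<integral>x. u x \<theta> \<partial>D) = (\<integral>x. enn2real (f x \<theta>\<^sub>0) *\<^sub>R u x \<theta> \<partial>\<mu>)"
      unfolding law_real using u_meas[OF that] by (intro integral_density) auto
    also have "\<dots> = (\<integral>x. - (ln (enn2real (f x \<theta>)) * enn2real (f x \<theta>\<^sub>0)) \<partial>\<mu>)"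
    proof (rule Bochner_Integration.integral_cong[OF refl])
      fix x
      show "enn2real (f x \<theta>\<^sub>0) *\<^sub>R u x \<theta> = - (ln (enn2real (f x \<theta>)) * enn2real (f x \<theta>\<^sub>0))"
      proof (cases "x \<in> S")
        case True
        then show ?thesis by (simp add: u_def)
      next
        case False
        then have "f x \<theta>\<^sub>0 = 0 \<or> f x \<theta>\<^sub>0 = \<infinity>"
          using S_iff[OF true_parameter, of x] by (auto simp: less_top zero_less_iff_neq_zero)
        then have "enn2real (f x \<theta>\<^sub>0) = 0" by auto
        then show ?thesis by simp
      qed
    qed
    also have "\<dots> = s \<theta>"
      by (simp add: s_def cross_entropy_def)
    finally show ?thesis .
  qed

  \<comment> \<open>The dominating function: restricting the supremum to a countable dense set makes it measurable.
    It is finite everywhere because \<open>u x\<close> is continuous on the compact set \<open>K\<close>.\<close>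
  obtain Q where Q: "countable Q" "Q \<subseteq> K" "closure Q = K"
    by (rule countable_dense_subset_compact[OF K])
  define H where "H x = (SUP \<phi>\<in>Q. ennreal \<bar>u x \<phi>\<bar>)" for x
  define G where "G x = enn2real (H x)" for x
  have H[measurable]: "H \<in> borel_measurable \<mu>"
    unfolding H_def using Q K_sub u_meas by (intro borel_measurable_SUP) auto
  have H_le: "H x * f x \<theta>\<^sub>0 \<le> (SUP \<phi>\<in>K. e2ennreal \<bar>elog (f x \<phi>)\<bar>) * f x \<theta>\<^sub>0" for x
  proof (cases "x \<in> S")
    case True
    have "ennreal \<bar>u x \<phi>\<bar> = e2ennreal \<bar>elog (f x \<phi>)\<bar>" if "\<phi> \<in> K" for \<phi>
      using S_iff[of \<phi> x] K_sub that True by (auto simp: u_def elog_def)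
    then have "H x \<le> (SUP \<phi>\<in>K. e2ennreal \<bar>elog (f x \<phi>)\<bar>)"
      unfolding H_def using Q(2) by (intro SUP_mono) (metis order_refl subsetD)
    then show ?thesis by (rule mult_right_mono) simp
  next
    case False
    then have "H x = 0"
      unfolding H_def by (simp add: u_def bot_ennreal[symmetric])
    then show ?thesis by simp
  qed
  have G: "integrable D G"
  proof (rule integrableI_bounded)
    show "G \<in> borel_measurable D"
      unfolding D_def G_def by simp
    have "(\<integral>\<^sup>+x. ennreal (norm (G x)) \<partial>D) = (\<integral>\<^sup>+x. f x \<theta>\<^sub>0 * ennreal (G x) \<partial>\<mu>)"
      unfolding D_def law by (subst nn_integral_density) (auto simp: G_def)
    also have "\<dots> \<le> (\<integral>\<^sup>+x. (SUP \<phi>\<in>K. e2ennreal \<bar>elog (f x \<phi>)\<bar>) * f x \<theta>\<^sub>0 \<partial>\<mu>)"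
    proof (rule nn_integral_mono)
      fix x
      have "f x \<theta>\<^sub>0 * ennreal (G x) \<le> H x * f x \<theta>\<^sub>0"
        unfolding G_def by (subst mult.commute, intro mult_right_mono)
          (auto simp: ennreal_enn2real_if)
      then show "f x \<theta>\<^sub>0 * ennreal (G x) \<le> (SUP \<phi>\<in>K. e2ennreal \<bar>elog (f x \<phi>)\<bar>) * f x \<theta>\<^sub>0"
        using H_le by (rule order_trans)
    qed
    also have "\<dots> < \<infinity>"
      by (rule locally_dominated[OF true_parameter K K_sub])
    finally show "(\<integral>\<^sup>+x. ennreal (norm (G x)) \<partial>D) < \<infinity>" .
  qed
  have dom: "\<bar>u x \<theta>\<bar> \<le> G x" if "\<theta> \<in> K" for x \<theta>
  proof -
    have "bounded (u x ` K)"
      by (rule compact_imp_bounded[OF compact_continuous_image[OF u_cont K]])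
    then obtain C where C: "\<And>\<phi>. \<phi> \<in> K \<Longrightarrow> \<bar>u x \<phi>\<bar> \<le> C"
      unfolding bounded_iff by auto
    have "H x \<le> ennreal C"
      unfolding H_def using Q(2) C by (intro SUP_least ennreal_leI) auto
    then have H_fin: "H x < top"
      using ennreal_less_top le_less_trans by blast
    show ?thesis
    proof (rule continuous_le_on_closure[where S=Q and f="\<lambda>\<theta>. \<bar>u x \<theta>\<bar>"])
      show "continuous_on (closure Q) (\<lambda>\<theta>. \<bar>u x \<theta>\<bar>)"
        unfolding Q(3) by (intro continuous_on_rabs u_cont)
      show "\<theta> \<in> closure Q" using that Q(3) by simp
      fix \<phi> assume "\<phi> \<in> Q"
      then have "ennreal \<bar>u x \<phi>\<bar> \<le> H x"
        unfolding H_def by (rule SUP_upper)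
      from enn2real_mono[OF this H_fin] show "\<bar>u x \<phi>\<bar> \<le> G x"
        by (simp add: G_def)
    qed
  qed

  have s_A: "s \<theta> \<le> s \<theta>\<^sub>0 + \<delta>" if "\<theta> \<in> A" for \<theta>
    using that by (simp add: A_def s_def entropy_ball_def)
  have s_B: "s \<theta>\<^sub>0 + \<delta> < s \<theta>" if "\<theta> \<in> B" for \<theta>
    using that \<open>B \<subseteq> \<Theta> - entropy_ball \<mu> f \<Theta> \<theta>\<^sub>0 \<delta>\<close> by (auto simp: s_def entropy_ball_def not_le)
  \<comment> \<open>The gap that leaves room for two levels: the entropy attains its minimum on \<open>B\<close>. For empty \<open>B\<close>
    any number above the entropies on \<open>A\<close> will do.\<close>
  obtain m where m: "s \<theta>\<^sub>0 + \<delta> < m" "\<And>\<theta>. \<theta> \<in> B \<Longrightarrow> m \<le> s \<theta>"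
  proof (cases "B = {}")
    case True
    then show ?thesis using that[of "s \<theta>\<^sub>0 + \<delta> + 1"] by simp
  next
    case False
    have "continuous_on B s"
      unfolding s_def
      by (rule continuous_on_subset[OF entropy_continuous[OF true_parameter]])
        (use K_sub in \<open>auto simp: K_def\<close>)
    from continuous_attains_inf[OF \<open>compact B\<close> False this] that s_B show ?thesis by blast
  qed
  obtain c2 where c2: "s \<theta>\<^sub>0 + \<delta> < c2" "c2 < m" using dense[OF m(1)] by blast
  obtain c1 where c1: "s \<theta>\<^sub>0 + \<delta> < c1" "c1 < c2" using dense[OF c2(1)] by blast
  have sub: "A \<subseteq> K" "B \<subseteq> K" by (auto simp: K_def)

  obtain EA where EA: "\<And>n. EA n \<in> events" "(\<lambda>n. prob (EA n)) \<longlonglongrightarrow> 1"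
    "\<And>n \<omega> \<theta>. \<omega> \<in> EA n \<Longrightarrow> \<theta> \<in> A \<Longrightarrow> (\<Sum>i<n. u (X i \<omega>) \<theta>) \<le> real n * c1"
  proof (rule uniform_iid_average_below_with_high_probability[OF indep same A, of u G c1])
    show "(\<integral>x. u x \<theta> \<partial>distr M \<mu> (X 0)) < c1" if "\<theta> \<in> A" for \<theta>
      using u_mean[of \<theta>] s_A[OF that] c1 that A_sub by (auto simp: D_def)
  qed (use sub K_sub u_meas G dom continuous_on_subset[OF u_cont sub(1)] in \<open>auto simp: D_def\<close>)
  obtain EB where EB: "\<And>n. EB n \<in> events" "(\<lambda>n. prob (EB n)) \<longlonglongrightarrow> 1"
    "\<And>n \<omega> \<theta>. \<omega> \<in> EB n \<Longrightarrow> \<theta> \<in> B \<Longrightarrow> (\<Sum>i<n. - u (X i \<omega>) \<theta>) \<le> real n * (- c2)"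
  proof (rule uniform_iid_average_below_with_high_probability
      [OF indep same \<open>compact B\<close>, of "\<lambda>x \<theta>. - u x \<theta>" G "- c2"])
    show "(\<integral>x. - u x \<theta> \<partial>distr M \<mu> (X 0)) < - c2" if "\<theta> \<in> B" for \<theta>
      using u_mean[of \<theta>] m(2)[OF that] c2 that K_sub sub by (auto simp: D_def)
  qed (use sub K_sub u_meas G dom continuous_on_subset[OF u_cont sub(2)] in
      \<open>auto simp: D_def intro!: continuous_on_minus\<close>)

  have in_S: "AE \<omega> in M. \<forall>i. X i \<omega> \<in> S"
    unfolding AE_all_countable
  proof
    fix i
    have "AE x in \<mu>. 0 < f x \<theta>\<^sub>0 \<longrightarrow> x \<in> S"
      using finite by eventually_elim (simp add: S_iff[OF true_parameter])
    then have "AE x in distr M \<mu> (X i). x \<in> S"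
      unfolding law by (simp add: AE_density)
    then show "AE \<omega> in M. X i \<omega> \<in> S"
      by (subst (asm) AE_distr_iff) (auto simp: space_\<mu>)
  qed

  show ?thesis
    unfolding A_def[symmetric]
  proof (rule strongly_separates_if_bounded_apart[OF A \<open>compact B\<close>,
        where l="\<lambda>n \<omega> \<theta>. \<Sum>i<n. u (X i \<omega>) \<theta>" and E="\<lambda>n. EA n \<inter> EB n" and ?c1.0=c1 and ?c2.0=c2])
    show "(\<lambda>\<omega>. \<Sum>i<n. u (X i \<omega>) \<theta>) \<in> borel_measurable M" if "\<theta> \<in> A \<union> B" for n \<theta>
      using that K_sub by (intro borel_measurable_sum measurable_compose[OF rv u_meas]) (auto simp: K_def)
    show "continuous_on (A \<union> B) (\<lambda>\<theta>. \<Sum>i<n. u (X i \<omega>) \<theta>)" for n \<omega>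
      using u_cont by (intro continuous_on_sum) (simp add: K_def)
    show "AE \<omega> in M. \<forall>n. \<forall>\<theta>\<in>A \<union> B.
        - elog (likelihood f X n \<omega> \<theta>) = ereal (\<Sum>i<n. u (X i \<omega>) \<theta>)"
      using in_S
    proof eventually_elim
      fix \<omega> assume \<omega>: "\<forall>i. X i \<omega> \<in> S"
      show "\<forall>n. \<forall>\<theta>\<in>A \<union> B. - elog (likelihood f X n \<omega> \<theta>) = ereal (\<Sum>i<n. u (X i \<omega>) \<theta>)"
      proof (intro allI ballI)
        fix n \<theta> assume "\<theta> \<in> A \<union> B"
        then have "\<theta> \<in> \<Theta>" using K_sub by (auto simp: K_def)
        then show "- elog (likelihood f X n \<omega> \<theta>) = ereal (\<Sum>i<n. u (X i \<omega>) \<theta>)"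
          using \<omega> S_iff by (subst neg_elog_likelihood) (auto simp: u_def)
      qed
    qed
    show "(\<lambda>n. prob (EA n \<inter> EB n)) \<longlonglongrightarrow> 1"
      by (rule high_probability_Int[OF EA(1) EB(1) EA(2) EB(2)])
    show "real n * c2 \<le> (\<Sum>i<n. u (X i \<omega>) \<theta>)" if "\<omega> \<in> EA n \<inter> EB n" "\<theta> \<in> B" for n \<omega> \<theta>
      using EB(3)[of \<omega> n \<theta>] that by (simp add: sum_negf)
  qed (use EA EB c1 in auto)
qed

end
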